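(* Let $G$ be a topological group and let $d$ be a bounded, continuous, right-invariant pseudo-metric on $G$. Let $D\subseteq[0,1]$ be a dense subset with $\{0,1\}\subseteq D$. Suppose that there exists a family of continuous endomorphisms $\phi_t\colon G\to G$ $(t\in D)$ such that (1) $\phi_0(G)=\{e\}$ and $\phi_1(G)=G$; (2) if $s,t\in D$ and $s\le t$, then $\phi_s(G)\subseteq\phi_t(G)$; (3) there exists a real $C\ge0$ such that $d(g\phi_s(h),g\phi_t(h))\le C\cdot|s-t|$ for all $s,t\in D$ and all $g,h\in G$. If $G$ is amenable, then $\ell(G,d)=0$.
   Context: For a topological group $G$, $\mathrm{RUCB}(G)$ is the algebra of all bounded functions $f\colon G\to\mathbb{R}$ such that for every $\epsilon>0$ there is a neighborhood $U$ of $e$ with $\sup_{x\in G}|f(x)-f(gx)|\le\epsilon$ for all $g\in U$. $G$ is amenable if there is a positive unital linear functional $\mu$ on $\mathrm{RUCB}(G)$ with $\mu(f\circ\lambda_g)=\mu(f)$ for all $f\in\mathrm{RUCB}(G)$, $g\in G$, where $\lambda_g(x)=gx$. Subgroups carry the relative topology. A pseudo-metric $d$ on $G$ is continuous if the topology it generates is contained in that of $G$, and right-invariant if $d(xg,yg)=d(x,y)$ for all $g,x,y\in G$. $\mathscr{A}^*(G)$ is the set of all finite tuples $(G_0,\dots,G_n)$, $n\in\mathbb{N}$, of subgroups of $G$, each amenable in the relative topology, with $\{e\}=G_0\le\dots\le G_n=G$. For a bounded, continuous, right-invariant pseudo-metric $d$ on $G$ and $(G_0,\dots,G_n)\in\mathscr{A}^*(G)$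 let $$\ell(G_0,\dots,G_n;d):=\Bigl(\sum_{i=0}^{n-1}\bigl(\sup_{g\in G}\operatorname{diam}(G_{i+1}/G_i,d_i^g)\bigr)^2\Bigr)^{1/2},\qquad d_i^g(xG_i,yG_i):=\inf_{h\in G_i}d(gx,gyh).$$ The amenable length is $\ell(G,d):=\inf\{\ell(G_0,\dots,G_n;d)\mid(G_0,\dots,G_n)\in\mathscr{A}^*(G)\}\in[0,\infty]$. *)

theory Defs
  imports "HOL-Analysis.Analysis" "HOL-Algebra.Coset" "HOL-Algebra.Left_Coset"
begin

text \<open>A topological group is a group together with a topology on its carrier; no separation
  axiom is assumed. A subgroup \<open>H\<close> of \<open>G\<close> with the relative topology is the pair
  \<open>G\<lparr>carrier := H\<rparr>\<close>, \<open>subtopology T H\<close>.\<close>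

locale topological_group = group G for G (structure) +
  fixes T :: "'a topology"
  assumes topspace_eq: "topspace T = carrier G"
    and continuous_mult: "continuous_map (prod_topology T T) T (\<lambda>(x, y). x \<otimes> y)"
    and continuous_inv: "continuous_map T T (\<lambda>x. inv x)"

text \<open>Functions on \<open>G\<close> are represented by total functions of which only the values on the carrier
  matter. Positivity below refers to the carrier only, so a linear positive functional takes the
  same value on any two representatives of the same function on \<open>G\<close>.\<close>

definition RUCB :: "('a, 'b) monoid_scheme \<Rightarrow> 'a topology \<Rightarrow> ('a \<Rightarrow> real) set" where
  "RUCB G T = {f. bounded (f ` carrier G) \<and>
     (\<forall>\<epsilon>>0. \<exists>U. openin T U \<and> \<one>\<^bsub>G\<^esub> \<in> U \<and>
        (\<forall>g\<in>U. (SUP x\<in>carrier G. \<bar>f x - f (g \<otimes>\<^bsub>G\<^esub> x)\<bar>) \<le> \<epsilon>))}"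

definition invariant_mean ::
  "('a, 'b) monoid_scheme \<Rightarrow> 'a topology \<Rightarrow> (('a \<Rightarrow> real) \<Rightarrow> real) \<Rightarrow> bool" where
  "invariant_mean G T \<mu> \<longleftrightarrow>
     (\<forall>f\<in>RUCB G T. \<forall>f'\<in>RUCB G T. \<mu> (\<lambda>x. f x + f' x) = \<mu> f + \<mu> f') \<and>
     (\<forall>f\<in>RUCB G T. \<forall>c. \<mu> (\<lambda>x. c * f x) = c * \<mu> f) \<and>
     (\<forall>f\<in>RUCB G T. (\<forall>x\<in>carrier G. 0 \<le> f x) \<longrightarrow> 0 \<le> \<mu> f) \<and>
     \<mu> (\<lambda>_. 1) = 1 \<and>
     (\<forall>f\<in>RUCB G T. \<forall>g\<in>carrier G. \<mu> (\<lambda>x. f (g \<otimes>\<^bsub>G\<^esub> x)) = \<mu> f)"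

definition amenable :: "('a, 'b) monoid_scheme \<Rightarrow> 'a topology \<Rightarrow> bool" where
  "amenable G T \<longleftrightarrow> (\<exists>\<mu>. invariant_mean G T \<mu>)"

definition pseudo_metric_on :: "'a set \<Rightarrow> ('a \<Rightarrow> 'a \<Rightarrow> real) \<Rightarrow> bool" where
  "pseudo_metric_on S d \<longleftrightarrow>
     (\<forall>x\<in>S. d x x = 0) \<and>
     (\<forall>x\<in>S. \<forall>y\<in>S. 0 \<le> d x y \<and> d x y = d y x) \<and>
     (\<forall>x\<in>S. \<forall>y\<in>S. \<forall>z\<in>S. d x z \<le> d x y + d y z)"

definition pseudo_metric_topology :: "'a set \<Rightarrow> ('a \<Rightarrow> 'a \<Rightarrow> real) \<Rightarrow> 'a topology" where
  "pseudo_metric_topology S d =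
     topology_generated_by {{y \<in> S. d x y < r} | x r. x \<in> S \<and> 0 < r}"

definition continuous_pseudo_metric :: "'a topology \<Rightarrow> ('a \<Rightarrow> 'a \<Rightarrow> real) \<Rightarrow> bool" where
  "continuous_pseudo_metric T d \<longleftrightarrow>
     (\<forall>U. openin (pseudo_metric_topology (topspace T) d) U \<longrightarrow> openin T U)"

definition bounded_pseudo_metric :: "'a set \<Rightarrow> ('a \<Rightarrow> 'a \<Rightarrow> real) \<Rightarrow> bool" where
  "bounded_pseudo_metric S d \<longleftrightarrow> (\<exists>B. \<forall>x\<in>S. \<forall>y\<in>S. d x y \<le> B)"

definition right_invariant ::
  "('a, 'b) monoid_scheme \<Rightarrow> ('a \<Rightarrow> 'a \<Rightarrow> real) \<Rightarrow> bool" where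
  "right_invariant G d \<longleftrightarrow>
     (\<forall>g\<in>carrier G. \<forall>x\<in>carrier G. \<forall>y\<in>carrier G.
        d (x \<otimes>\<^bsub>G\<^esub> g) (y \<otimes>\<^bsub>G\<^esub> g) = d x y)"

text \<open>The list \<open>[G\<^sub>0, \<dots>, G\<^sub>n]\<close> represents the chain \<open>{e} = G\<^sub>0 \<le> \<dots> \<le> G\<^sub>n = G\<close>.\<close>

definition amenable_chains :: "('a, 'b) monoid_scheme \<Rightarrow> 'a topology \<Rightarrow> 'a set list set" where
  "amenable_chains G T = {Gs. Gs \<noteq> [] \<and> hd Gs = {\<one>\<^bsub>G\<^esub>} \<and> last Gs = carrier G \<and>
     (\<forall>H\<in>set Gs. subgroup H G \<and> amenable (G\<lparr>carrier := H\<rparr>) (subtopology T H)) \<and>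
     (\<forall>i < length Gs - 1. Gs ! i \<subseteq> Gs ! Suc i)}"

text \<open>The pseudo-metric \<open>(xH, yH) \<mapsto> inf\<^bsub>h\<in>H\<^esub> d(gx, gyh)\<close> on left cosets of \<open>H\<close>. It does not depend
  on the representatives if \<open>d\<close> is right-invariant, see \<open>coset_dist_l_coset\<close>.\<close>

definition coset_dist ::
  "('a, 'b) monoid_scheme \<Rightarrow> ('a \<Rightarrow> 'a \<Rightarrow> real) \<Rightarrow> 'a set \<Rightarrow> 'a \<Rightarrow> 'a set \<Rightarrow> 'a set \<Rightarrow> real" where
  "coset_dist G d H g A B =
     (THE r. \<exists>x\<in>A. \<exists>y\<in>B. r = (INF h\<in>H. d (g \<otimes>\<^bsub>G\<^esub> x) (g \<otimes>\<^bsub>G\<^esub> y \<otimes>\<^bsub>G\<^esub> h)))"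

lemma (in group) coset_dist_l_coset:
  assumes H: "subgroup H G" and d: "right_invariant G d"
    and g: "g \<in> carrier G" and x: "x \<in> carrier G" and y: "y \<in> carrier G"
  shows "coset_dist G d H g (x <# H) (y <# H) = (INF h\<in>H. d (g \<otimes> x) (g \<otimes> y \<otimes> h))"
proof -
  interpret H: subgroup H G by (fact H)
  have indep: "(INF h\<in>H. d (g \<otimes> (x \<otimes> k)) (g \<otimes> (y \<otimes> l) \<otimes> h))
      = (INF h\<in>H. d (g \<otimes> x) (g \<otimes> y \<otimes> h))" if k: "k \<in> H" and l: "l \<in> H" for k l
  proof -
    have shift: "d (g \<otimes> (x \<otimes> k)) (g \<otimes> (y \<otimes> l) \<otimes> h) = d (g \<otimes> x) (g \<otimes> y \<otimes> (l \<otimes> h \<otimes> inv k))"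
      if h: "h \<in> H" for h
    proof -
      have "d (g \<otimes> x) (g \<otimes> y \<otimes> (l \<otimes> h \<otimes> inv k))
          = d (g \<otimes> x \<otimes> k) (g \<otimes> y \<otimes> (l \<otimes> h \<otimes> inv k) \<otimes> k)"
        using d g x y k l h by (simp add: right_invariant_def)
      also have "g \<otimes> y \<otimes> (l \<otimes> h \<otimes> inv k) \<otimes> k = g \<otimes> (y \<otimes> l) \<otimes> h"
        using g y k l h by (simp add: m_assoc)
      finally show ?thesis using g x k by (simp add: m_assoc)
    qed
    have "(\<lambda>h. l \<otimes> h \<otimes> inv k) ` H = H"
    proof (intro equalityI subsetI)
      fix h assume h: "h \<in> H"
      have "l \<otimes> (inv l \<otimes> h \<otimes> k) \<otimes> inv k = (l \<otimes> inv l) \<otimes> h \<otimes> (k \<otimes> inv k)"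
        by (simp only: m_assoc m_closed inv_closed H.mem_carrier h k l)
      also have "\<dots> = h" using h k l by (simp only: r_inv l_one r_one H.mem_carrier)
      finally have "h = l \<otimes> (inv l \<otimes> h \<otimes> k) \<otimes> inv k" by (rule sym)
      moreover have "inv l \<otimes> h \<otimes> k \<in> H"
        by (intro H.m_closed H.m_inv_closed h k l)
      ultimately show "h \<in> (\<lambda>h. l \<otimes> h \<otimes> inv k) ` H" by blast
    qed (auto intro!: H.m_closed H.m_inv_closed k l)
    then have "(\<lambda>h. d (g \<otimes> x) (g \<otimes> y \<otimes> h)) ` H
        = (\<lambda>h. d (g \<otimes> x) (g \<otimes> y \<otimes> (l \<otimes> h \<otimes> inv k))) ` H"
      using image_image[of "\<lambda>h. d (g \<otimes> x) (g \<otimes> y \<otimes> h)" "\<lambda>h. l \<otimes> h \<otimes> inv k" H] by (simp only:)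
    moreover have "(\<lambda>h. d (g \<otimes> (x \<otimes> k)) (g \<otimes> (y \<otimes> l) \<otimes> h)) ` H
        = (\<lambda>h. d (g \<otimes> x) (g \<otimes> y \<otimes> (l \<otimes> h \<otimes> inv k))) ` H"
      by (rule image_cong[OF refl shift])
    ultimately show ?thesis by (simp only:)
  qed
  have mem: "x \<in> x <# H" "y \<in> y <# H"
    using x y H.one_closed by (force simp: l_coset_def)+
  show ?thesis unfolding coset_dist_def
  proof (rule the_equality)
    show "\<exists>x'\<in>x <# H. \<exists>y'\<in>y <# H. (INF h\<in>H. d (g \<otimes> x) (g \<otimes> y \<otimes> h))
        = (INF h\<in>H. d (g \<otimes> x') (g \<otimes> y' \<otimes> h))"
      using mem by blast
  qed (use indep in \<open>auto simp: l_coset_def\<close>)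
qed

definition chain_length ::
  "('a, 'b) monoid_scheme \<Rightarrow> ('a \<Rightarrow> 'a \<Rightarrow> real) \<Rightarrow> 'a set list \<Rightarrow> real" where
  "chain_length G d Gs = sqrt (\<Sum>i < length Gs - 1.
     (SUP g\<in>carrier G.
        (SUP (A, B) \<in> (lcosets\<^bsub>G\<lparr>carrier := Gs ! Suc i\<rparr>\<^esub> (Gs ! i)) \<times>
                     (lcosets\<^bsub>G\<lparr>carrier := Gs ! Suc i\<rparr>\<^esub> (Gs ! i)).
           coset_dist G d (Gs ! i) g A B))\<^sup>2)"

text \<open>The infimum is \<open>\<infinity>\<close> if there is no chain. For bounded \<open>d\<close> each \<open>chain_length\<close> is a
  well-defined nonnegative real.\<close>

definition amenable_length ::
  "('a, 'b) monoid_scheme \<Rightarrow> 'a topology \<Rightarrow> ('a \<Rightarrow> 'a \<Rightarrow> real) \<Rightarrow> ennreal" where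
  "amenable_length G T d = (INF Gs\<in>amenable_chains G T. ennreal (chain_length G d Gs))"

end

(* For a fine partition 0 = t 0 <= ... <= t n = 1 inside D, the images G_i of the phi_(t i) form a
   chain of amenable subgroups, because amenability passes to continuous homomorphic images. Given
   x = phi_t(h) and y = phi_t(k) in G_(i+1) (with s = t i, t = t (i+1)), put m = k^-1 h, so that
   gx = g y phi_t(m), while g y phi_s(m) lies in g y G_i. Hence the diameter of G_(i+1)/G_i is at most
   C |t - s| <= 2C/n, and the squares of these diameters sum up to at most 4C^2/n. *)

theory Submission
  imports Defs
begin

section \<open>Amenability under continuous homomorphisms and passage to subgroups\<close>

text \<open>A mean acts on total functions, so values off the carrier must be shown to be harmless.
  The difference \<open>h\<close> vanishes on the carrier; positivity applied to \<open>h\<close>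
  and to its negative forces \<open>\<mu> h = 0\<close>.\<close>

lemma invariant_mean_cong:
  assumes "topological_group G T" and \<mu>: "invariant_mean G T \<mu>"
    and f: "f \<in> RUCB G T" "f' \<in> RUCB G T" and eq: "\<And>x. x \<in> carrier G \<Longrightarrow> f x = f' x"
  shows "\<mu> f = \<mu> f'"
proof -
  interpret topological_group G T by fact
  define h where "h = (\<lambda>x. f x - f' x)"
  have h0: "h x = 0" if "x \<in> carrier G" for x
    using eq that by (simp add: h_def)
  \<comment> \<open>Stated for arbitrary \<open>u\<close> because it serves both \<open>h\<close>
    and its negative. The whole carrier works as the neighborhood for every \<epsilon>.\<close>
  have null: "u \<in> RUCB G T" if u: "\<And>x. x \<in> carrier G \<Longrightarrow> u x = 0" for u
    unfolding RUCB_def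
  proof (intro CollectI conjI allI impI)
    show "bounded (u ` carrier G)"
      by (rule bounded_subset[of "{0}"]) (auto simp: u)
    fix \<epsilon> :: real assume "\<epsilon> > 0"
    show "\<exists>U. openin T U \<and> \<one>\<^bsub>G\<^esub> \<in> U \<and>
        (\<forall>g\<in>U. (SUP x\<in>carrier G. \<bar>u x - u (g \<otimes>\<^bsub>G\<^esub> x)\<bar>) \<le> \<epsilon>)"
    proof (intro exI conjI ballI)
      show "openin T (carrier G)" using openin_topspace[of T] by (simp add: topspace_eq)
      fix g assume "g \<in> carrier G"
      then show "(SUP x\<in>carrier G. \<bar>u x - u (g \<otimes>\<^bsub>G\<^esub> x)\<bar>) \<le> \<epsilon>"
        using \<open>\<epsilon> > 0\<close> by (intro cSUP_least) (auto simp: u)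
    qed simp
  qed
  have h: "h \<in> RUCB G T" by (rule null[OF h0])
  have nonneg: "0 \<le> \<mu> u" if "u \<in> RUCB G T" "\<And>x. x \<in> carrier G \<Longrightarrow> 0 \<le> u x" for u
    using \<mu> that unfolding invariant_mean_def by blast
  have scale: "\<mu> (\<lambda>x. c * u x) = c * \<mu> u" if "u \<in> RUCB G T" for u c
    using \<mu> that unfolding invariant_mean_def by blast
  have "(\<lambda>x. - 1 * h x) \<in> RUCB G T" by (rule null) (simp add: h0)
  then have "0 \<le> \<mu> (\<lambda>x. - 1 * h x)" by (rule nonneg) (simp add: h0)
  moreover have "0 \<le> \<mu> h" by (rule nonneg) (simp_all add: h h0)
  ultimately have "\<mu> h = 0" using scale[OF h, of "- 1"] by simp
  \<comment> \<open>The sum of \<open>f'\<close> and \<open>h\<close> equals \<open>f\<close>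
    everywhere, also off the carrier, so additivity finishes the argument.\<close>
  moreover have "\<mu> (\<lambda>x. f' x + h x) = \<mu> f' + \<mu> h"
    using \<mu> f h unfolding invariant_mean_def by blast
  ultimately show ?thesis by (simp add: h_def)
qed

text \<open>If \<open>U\<close> witnesses uniform continuity of \<open>f\<close>, its preimage
  witnesses it for the composition, since \<phi> turns translation by \<open>g\<close> into
  translation by \<open>\<phi> g\<close>. Surjectivity makes both suprema range over the same set of
  values.\<close>

lemma RUCB_compose_hom:
  assumes "group G" "group H" and top: "topspace T = carrier G"
    and \<phi>: "\<phi> \<in> hom G H" and surj: "\<phi> ` carrier G = carrier H" and cont: "continuous_map T S \<phi>"
    and f: "f \<in> RUCB H S"
  shows "(\<lambda>x. f (\<phi> x)) \<in> RUCB G T"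
  unfolding RUCB_def
proof (intro CollectI conjI allI impI)
  interpret group_hom G H \<phi>
    using assms by (simp add: group_hom_def group_hom_axioms_def)
  show "bounded ((\<lambda>x. f (\<phi> x)) ` carrier G)"
    using f surj unfolding RUCB_def by (auto simp flip: image_image[of f \<phi>])
  fix \<epsilon> :: real assume "\<epsilon> > 0"
  with f obtain U where U: "openin S U" "\<one>\<^bsub>H\<^esub> \<in> U"
    "\<And>g. g \<in> U \<Longrightarrow> (SUP x\<in>carrier H. \<bar>f x - f (g \<otimes>\<^bsub>H\<^esub> x)\<bar>) \<le> \<epsilon>"
    unfolding RUCB_def by blast
  let ?V = "{x \<in> topspace T. \<phi> x \<in> U}"
  have "(SUP x\<in>carrier G. \<bar>f (\<phi> x) - f (\<phi> (g \<otimes>\<^bsub>G\<^esub> x))\<bar>) \<le> \<epsilon>" if g: "g \<in> ?V" for g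
  proof -
    have "(\<lambda>x. \<bar>f (\<phi> x) - f (\<phi> (g \<otimes>\<^bsub>G\<^esub> x))\<bar>) ` carrier G
        = (\<lambda>x. \<bar>f (\<phi> x) - f (\<phi> g \<otimes>\<^bsub>H\<^esub> \<phi> x)\<bar>) ` carrier G"
      using g top by (intro image_cong) auto
    also have "\<dots> = (\<lambda>x. \<bar>f x - f (\<phi> g \<otimes>\<^bsub>H\<^esub> x)\<bar>) ` carrier H"
      unfolding surj[symmetric] image_image ..
    finally show ?thesis using U(3)[of "\<phi> g"] g by simp
  qed
  moreover have "openin T ?V" using cont U(1) by (rule openin_continuous_map_preimage)
  moreover have "\<one>\<^bsub>G\<^esub> \<in> ?V" using U(2) top by simp
  ultimately show "\<exists>V. openin T V \<and> \<one>\<^bsub>G\<^esub> \<in> V \<and>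
      (\<forall>g\<in>V. (SUP x\<in>carrier G. \<bar>f (\<phi> x) - f (\<phi> (g \<otimes>\<^bsub>G\<^esub> x))\<bar>) \<le> \<epsilon>)" by blast
qed

text \<open>Since k(gx) = (k g k^-1)(kx), conjugation by \<open>k\<close> carries a neighborhood for
  the translate to one for \<open>f\<close>. This membership is what allows
  \<open>invariant_mean_cong\<close> to be applied to translated functions.\<close>

lemma RUCB_translate:
  assumes "topological_group G T" and f: "f \<in> RUCB G T" and k: "k \<in> carrier G"
  shows "(\<lambda>x. f (k \<otimes>\<^bsub>G\<^esub> x)) \<in> RUCB G T"
  unfolding RUCB_def
proof (intro CollectI conjI allI impI)
  interpret topological_group G T by fact
  have onto: "(\<lambda>x. k \<otimes>\<^bsub>G\<^esub> x) ` carrier G = carrier G"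
    using k surj_const_mult by blast
  show "bounded ((\<lambda>x. f (k \<otimes>\<^bsub>G\<^esub> x)) ` carrier G)"
    using f onto unfolding RUCB_def by (auto simp flip: image_image[of f "\<lambda>x. k \<otimes>\<^bsub>G\<^esub> x"])
  fix \<epsilon> :: real assume "\<epsilon> > 0"
  with f obtain U where U: "openin T U" "\<one>\<^bsub>G\<^esub> \<in> U"
    "\<And>g. g \<in> U \<Longrightarrow> (SUP x\<in>carrier G. \<bar>f x - f (g \<otimes>\<^bsub>G\<^esub> x)\<bar>) \<le> \<epsilon>"
    unfolding RUCB_def by blast
  let ?c = "\<lambda>g. k \<otimes>\<^bsub>G\<^esub> g \<otimes>\<^bsub>G\<^esub> inv\<^bsub>G\<^esub> k"
  \<comment> \<open>This is the conjugate k^-1 U k, written as a preimage so that its openness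
    follows from continuity of conjugation.\<close>
  let ?V = "{g \<in> topspace T. ?c g \<in> U}"
  have mult: "continuous_map T T (\<lambda>x. u x \<otimes>\<^bsub>G\<^esub> v x)"
    if "continuous_map T T u" "continuous_map T T v" for u v
    using continuous_map_compose[OF continuous_map_pairedI[OF that] continuous_mult]
    by (simp add: o_def)
  have "continuous_map T T ?c"
    using k by (intro mult) (auto simp: topspace_eq)
  then have "openin T ?V" using U(1) by (rule openin_continuous_map_preimage)
  moreover have "\<one>\<^bsub>G\<^esub> \<in> ?V" using U(2) k by (simp add: topspace_eq)
  moreover have "(SUP x\<in>carrier G. \<bar>f (k \<otimes>\<^bsub>G\<^esub> x) - f (k \<otimes>\<^bsub>G\<^esub> (g \<otimes>\<^bsub>G\<^esub> x))\<bar>) \<le> \<epsilon>"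
    if g: "g \<in> ?V" for g
  proof -
    have "k \<otimes>\<^bsub>G\<^esub> (g \<otimes>\<^bsub>G\<^esub> x) = ?c g \<otimes>\<^bsub>G\<^esub> (k \<otimes>\<^bsub>G\<^esub> x)" if "x \<in> carrier G" for x
      using that k g by (simp add: topspace_eq m_assoc inv_solve_left)
    then have "(\<lambda>x. \<bar>f (k \<otimes>\<^bsub>G\<^esub> x) - f (k \<otimes>\<^bsub>G\<^esub> (g \<otimes>\<^bsub>G\<^esub> x))\<bar>) ` carrier G
        = (\<lambda>x. \<bar>f (k \<otimes>\<^bsub>G\<^esub> x) - f (?c g \<otimes>\<^bsub>G\<^esub> (k \<otimes>\<^bsub>G\<^esub> x))\<bar>) ` carrier G"
      by (intro image_cong) auto
    \<comment> \<open>Left multiplication by \<open>k\<close> permutes the carrier, so kx may be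
      replaced by x without changing the set of values.\<close>
    also have "\<dots> = (\<lambda>x. \<bar>f x - f (?c g \<otimes>\<^bsub>G\<^esub> x)\<bar>) ` carrier G"
      by (subst (2) onto[symmetric]) (simp only: image_image)
    finally show ?thesis using U(3)[of "?c g"] g by simp
  qed
  ultimately show "\<exists>V. openin T V \<and> \<one>\<^bsub>G\<^esub> \<in> V \<and>
      (\<forall>g\<in>V. (SUP x\<in>carrier G. \<bar>f (k \<otimes>\<^bsub>G\<^esub> x) - f (k \<otimes>\<^bsub>G\<^esub> (g \<otimes>\<^bsub>G\<^esub> x))\<bar>) \<le> \<epsilon>)" by blast
qed

text \<open>The mean is pushed forward along \<phi>: a function \<open>f\<close> on the image is
  sent to the mean of its composition with \<phi>. Translation by \<open>\<phi> k\<close> downstairs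
  becomes translation by \<open>k\<close> upstairs.\<close>

lemma amenable_hom_image:
  assumes "topological_group G T" "topological_group H S"
    and \<phi>: "\<phi> \<in> hom G H" and surj: "\<phi> ` carrier G = carrier H" and cont: "continuous_map T S \<phi>"
    and "amenable G T"
  shows "amenable H S"
proof -
  interpret G: topological_group G T by fact
  interpret H: topological_group H S by fact
  obtain \<mu> where \<mu>: "invariant_mean G T \<mu>"
    using \<open>amenable G T\<close> unfolding amenable_def by blast
  have inv: "\<mu> (\<lambda>x. f (g \<otimes>\<^bsub>G\<^esub> x)) = \<mu> f" if "f \<in> RUCB G T" "g \<in> carrier G" for f g
    using \<mu> that unfolding invariant_mean_def by blast
  have nonneg: "0 \<le> \<mu> f" if "f \<in> RUCB G T" "\<And>x. x \<in> carrier G \<Longrightarrow> 0 \<le> f x" for f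
    using \<mu> that unfolding invariant_mean_def by blast
  note compose = RUCB_compose_hom[OF G.group_axioms H.group_axioms G.topspace_eq \<phi> surj cont]
  have "invariant_mean H S (\<lambda>f. \<mu> (\<lambda>x. f (\<phi> x)))"
    unfolding invariant_mean_def
  proof (intro conjI ballI allI impI)
    fix f g assume f: "f \<in> RUCB H S" and "g \<in> carrier H"
    with surj obtain k where k: "k \<in> carrier G" "g = \<phi> k" by blast
    \<comment> \<open>Multiplicativity of \<phi> is available on the carrier only, so the two
      functions are compared there. One is a translate composed with \<phi>, the other a composition
      that is then translated.\<close>
    have "\<mu> (\<lambda>x. f (g \<otimes>\<^bsub>H\<^esub> \<phi> x)) = \<mu> (\<lambda>x. f (\<phi> (k \<otimes>\<^bsub>G\<^esub> x)))"
      using \<phi> k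
      by (intro invariant_mean_cong[OF assms(1) \<mu>]
          compose[OF RUCB_translate[OF assms(2) f \<open>g \<in> carrier H\<close>]]
          RUCB_translate[OF assms(1) compose[OF f]])
        (auto simp: hom_mult)
    also have "\<dots> = \<mu> (\<lambda>x. f (\<phi> x))"
      by (rule inv[OF compose[OF f] k(1)])
    finally show "\<mu> (\<lambda>x. f (g \<otimes>\<^bsub>H\<^esub> \<phi> x)) = \<mu> (\<lambda>x. f (\<phi> x))" .
  next
    fix f assume "f \<in> RUCB H S" "\<forall>x\<in>carrier H. 0 \<le> f x"
    then show "0 \<le> \<mu> (\<lambda>x. f (\<phi> x))" using surj by (intro nonneg compose) blast+
  qed (use \<mu> compose in \<open>simp_all add: invariant_mean_def\<close>)
  then show ?thesis unfolding amenable_def by blast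
qed

lemma topological_group_subgroup:
  assumes "topological_group G T" and H: "subgroup H G"
  shows "topological_group (G\<lparr>carrier := H\<rparr>) (subtopology T H)"
proof -
  interpret topological_group G T by fact
  interpret subgroup H G by fact
  have top: "topspace (subtopology T H) = H"
    using subset by (auto simp: topspace_eq)
  have "continuous_map (prod_topology (subtopology T H) (subtopology T H)) (subtopology T H)
      (\<lambda>(x, y). x \<otimes>\<^bsub>G\<^esub> y)"
    using continuous_map_from_subtopology[OF continuous_mult, of "H \<times> H"] top
    by (auto simp: continuous_map_in_subtopology prod_topology_subtopology subtopology_subtopology
        Times_Int_Times)
  moreover have "continuous_map (subtopology T H) (subtopology T H) (\<lambda>x. inv\<^bsub>G\<lparr>carrier := H\<rparr>\<^esub> x)"
  \<comment> \<open>Inversion in the restricted structure is exchanged for inversion in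
    \<open>G\<close>, with which it agrees on \<open>H\<close>.\<close>
  proof (rule continuous_map_eq)
    show "continuous_map (subtopology T H) (subtopology T H) (\<lambda>x. inv\<^bsub>G\<^esub> x)"
      using continuous_map_from_subtopology[OF continuous_inv, of H] top
      by (auto simp: continuous_map_in_subtopology)
  qed (use m_inv_consistent[OF H] top in auto)
  ultimately show ?thesis
    using subgroup_is_group[OF group_axioms] top
    by (simp add: topological_group_def topological_group_axioms_def)
qed

section \<open>Fine partitions and the diameter of one quotient\<close>

text \<open>Each grid point i/n is approximated within \<open>D\<close> up to half the mesh.
  Neighbors then keep their order, and their gap is at most 1/n + 2 * 1/(2n) = 2/n.\<close>

lemma exists_fine_partition:
  fixes D :: "real set"
  assumes "{0..1} \<subseteq> closure D" "{0, 1} \<subseteq> D" and n: "n > 0"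
  obtains t :: "nat \<Rightarrow> real" where "t 0 = 0" "t n = 1" "\<And>i. i \<le> n \<Longrightarrow> t i \<in> D"
    "\<And>i. i < n \<Longrightarrow> t i \<le> t (Suc i) \<and> t (Suc i) - t i \<le> 2 / n"
proof -
  \<comment> \<open>The endpoints must be hit exactly, so that the chain starts at the trivial
    subgroup and ends at the whole group; here 0 and 1 in \<open>D\<close> are used.\<close>
  have "\<exists>t\<in>D. \<bar>t - i / n\<bar> \<le> 1 / (2 * real n) \<and> (i = 0 \<longrightarrow> t = 0) \<and> (i = n \<longrightarrow> t = 1)"
    if i: "i \<le> n" for i
  proof (cases "i = 0 \<or> i = n")
    case True
    then show ?thesis using assms by auto
  next
    case False
    have "i / n \<in> closure D" using i n by (intro subsetD[OF assms(1)]) simp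
    moreover have "0 < 1 / (2 * real n)" using n by simp
    ultimately obtain t where "t \<in> D" "dist t (i / n) < 1 / (2 * real n)"
      using closure_approachable[THEN iffD1, rule_format, of "i / n" D "1 / (2 * real n)"] by metis
    with False show ?thesis by (intro bexI[of _ t]) (auto simp: dist_real_def)
  qed
  then obtain t where t: "\<And>i. i \<le> n \<Longrightarrow> t i \<in> D \<and> \<bar>t i - i / n\<bar> \<le> 1 / (2 * real n) \<and>
      (i = 0 \<longrightarrow> t i = 0) \<and> (i = n \<longrightarrow> t i = 1)" by metis
  show thesis
  proof
    fix i assume "i < n"
    then have "\<bar>t i - i / n\<bar> \<le> 1 / (2 * real n)" "\<bar>t (Suc i) - Suc i / n\<bar> \<le> 1 / (2 * real n)"
      using t[of i] t[of "Suc i"] by auto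
    \<comment> \<open>With 1/(2n) as the unit, order and gap become linear inequalities.\<close>
    moreover have "Suc i / n = i / n + 2 * (1 / (2 * real n))" "2 / n = 4 * (1 / (2 * real n))"
      by (simp_all add: add_divide_distrib)
    ultimately show "t i \<le> t (Suc i) \<and> t (Suc i) - t i \<le> 2 / n"
      by linarith
  qed (use t[of 0] t[of n] t in auto)
qed

text \<open>Here \<phi> and \<psi> play the roles of two consecutive endomorphisms of the partition.
  One element of \<open>H\<close>, namely \<open>\<phi> m\<close>, bounds the infimum from above.
  The lower bound 0 is recorded because the diameters are squared later.\<close>

lemma (in group) coset_dist_image_bound:
  assumes d: "pseudo_metric_on (carrier G) d" "right_invariant G d"
    and \<phi>: "\<phi> \<in> hom G G" and \<psi>: "\<psi> \<in> hom G G"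
    and near: "\<And>g h. g \<in> carrier G \<Longrightarrow> h \<in> carrier G \<Longrightarrow> d (g \<otimes> \<phi> h) (g \<otimes> \<psi> h) \<le> r"
    and g: "g \<in> carrier G" and x: "x \<in> \<psi> ` carrier G" and y: "y \<in> \<psi> ` carrier G"
  defines "H \<equiv> \<phi> ` carrier G"
  shows "coset_dist G d H g (x <# H) (y <# H) \<in> {0..r}"
proof -
  interpret \<phi>: group_hom G G \<phi> using \<phi> by unfold_locales
  interpret \<psi>: group_hom G G \<psi> using \<psi> by unfold_locales
  have H: "subgroup H G" unfolding H_def by (rule \<phi>.img_is_subgroup)
  interpret H: subgroup H G by (fact H)
  obtain h k where h: "h \<in> carrier G" "x = \<psi> h" and k: "k \<in> carrier G" "y = \<psi> k"
    using x y by blast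
  have nonneg: "0 \<le> d (g \<otimes> x) (g \<otimes> y \<otimes> l)" if "l \<in> H" for l
    using d(1) g h k that by (auto simp: pseudo_metric_on_def)
  define m where "m = inv k \<otimes> h"
  have m: "m \<in> carrier G" using h k by (simp add: m_def)
  have "k \<otimes> m = h" using h k by (simp add: m_def m_assoc[symmetric])
  then have "x = y \<otimes> \<psi> m" using h k m by (metis \<psi>.hom_mult)
  \<comment> \<open>After substituting for \<open>x\<close> and using symmetry, \<open>near\<close>
    applies with \<open>g \<otimes> y\<close> as its left factor; this is why \<open>near\<close>
    must hold for all left factors.\<close>
  then have "d (g \<otimes> x) (g \<otimes> y \<otimes> \<phi> m) = d (g \<otimes> y \<otimes> \<phi> m) (g \<otimes> y \<otimes> \<psi> m)"
    using d(1) g k m by (auto simp: pseudo_metric_on_def m_assoc)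
  also have "\<dots> \<le> r" using near g k m by simp
  finally have "d (g \<otimes> x) (g \<otimes> y \<otimes> \<phi> m) \<le> r" .
  moreover have "\<phi> m \<in> H" using m by (simp add: H_def)
  ultimately have "(INF l\<in>H. d (g \<otimes> x) (g \<otimes> y \<otimes> l)) \<le> r"
    using nonneg by (intro cINF_lower2[of _ _ "\<phi> m"]) (auto intro!: bdd_belowI[of _ 0])
  moreover have "0 \<le> (INF l\<in>H. d (g \<otimes> x) (g \<otimes> y \<otimes> l))"
    using nonneg H.one_closed by (intro cINF_greatest) blast+
  ultimately show ?thesis
    using coset_dist_l_coset[OF H d(2) g, of x y] h k by simp
qed

text \<open>The upper end of the interval supplies the boundedness under which any single value lies
  below the supremum. Closed intervals are thus preserved, which suits the nested suprema over
  \<open>g\<close> and over pairs of cosets.\<close>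

lemma cSUP_atLeastAtMost:
  fixes f :: "'a \<Rightarrow> 'b::conditionally_complete_lattice"
  assumes "A \<noteq> {}" "\<And>x. x \<in> A \<Longrightarrow> f x \<in> {a..b}"
  shows "(SUP x\<in>A. f x) \<in> {a..b}"
proof -
  obtain x where "x \<in> A" using assms(1) by blast
  then have "a \<le> (SUP x\<in>A. f x)"
    using assms(2) by (intro cSUP_upper2[of f A x]) (auto intro!: bdd_aboveI2[of _ _ b])
  then show ?thesis using assms by (auto intro!: cSUP_least)
qed

section \<open>Chains of image subgroups and the limit of their lengths\<close>

theorem proposition4p15:
  fixes G :: "('a, 'b) monoid_scheme" and T :: "'a topology"
    and d :: "'a \<Rightarrow> 'a \<Rightarrow> real" and D :: "real set" and \<phi> :: "real \<Rightarrow> 'a \<Rightarrow> 'a"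
  assumes "topological_group G T"
    and "pseudo_metric_on (carrier G) d"
    and "bounded_pseudo_metric (carrier G) d"
    and "continuous_pseudo_metric T d"
    and "right_invariant G d"
    and "D \<subseteq> {0..1}" and "{0..1} \<subseteq> closure D" and "{0, 1} \<subseteq> D"
    and "\<And>t. t \<in> D \<Longrightarrow> \<phi> t \<in> hom G G \<and> continuous_map T T (\<phi> t)"
    and "\<phi> 0 ` carrier G = {\<one>\<^bsub>G\<^esub>}" and "\<phi> 1 ` carrier G = carrier G"
    and "\<And>s t. s \<in> D \<Longrightarrow> t \<in> D \<Longrightarrow> s \<le> t \<Longrightarrow> \<phi> s ` carrier G \<subseteq> \<phi> t ` carrier G"
    and "\<exists>C\<ge>0. \<forall>s\<in>D. \<forall>t\<in>D. \<forall>g\<in>carrier G. \<forall>h\<in>carrier G.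
           d (g \<otimes>\<^bsub>G\<^esub> \<phi> s h) (g \<otimes>\<^bsub>G\<^esub> \<phi> t h) \<le> C * \<bar>s - t\<bar>"
    and "amenable G T"
  shows "amenable_length G T d = 0"
proof -
  interpret topological_group G T by fact
  obtain C where C: "C \<ge> 0" "\<And>s t g h. s \<in> D \<Longrightarrow> t \<in> D \<Longrightarrow> g \<in> carrier G \<Longrightarrow> h \<in> carrier G \<Longrightarrow>
      d (g \<otimes>\<^bsub>G\<^esub> \<phi> s h) (g \<otimes>\<^bsub>G\<^esub> \<phi> t h) \<le> C * \<bar>s - t\<bar>"
    using assms(13) by blast
  have sub: "subgroup (\<phi> t ` carrier G) G" if "t \<in> D" for t
  proof -
    interpret group_hom G G "\<phi> t"
      using assms(9) that by unfold_locales auto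
    show ?thesis by (rule img_is_subgroup)
  qed
  \<comment> \<open>With its image as codomain, \<open>\<phi> t\<close> is a continuous surjective
    homomorphism from the amenable group \<open>G\<close>.\<close>
  have amen: "amenable (G\<lparr>carrier := \<phi> t ` carrier G\<rparr>) (subtopology T (\<phi> t ` carrier G))"
    if t: "t \<in> D" for t
  proof (rule amenable_hom_image[OF assms(1) topological_group_subgroup[OF assms(1) sub[OF t]]])
    show "\<phi> t \<in> hom G (G\<lparr>carrier := \<phi> t ` carrier G\<rparr>)"
      using assms(9)[OF t] by (auto simp: hom_def)
    show "continuous_map T (subtopology T (\<phi> t ` carrier G)) (\<phi> t)"
      using assms(9)[OF t] by (auto simp: continuous_map_in_subtopology topspace_eq)
  qed (use \<open>amenable G T\<close> in simp_all)
  have bound: "amenable_length G T d \<le> ennreal (sqrt (4 * C\<^sup>2 / n))" if n: "n > 0" for n :: nat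
  proof -
    obtain t where t: "t 0 = 0" "t n = 1" "\<And>i. i \<le> n \<Longrightarrow> t i \<in> D"
      "\<And>i. i < n \<Longrightarrow> t i \<le> t (Suc i) \<and> t (Suc i) - t i \<le> 2 / n"
      using exists_fine_partition[OF assms(7,8) n] by blast
    define H where "H i = \<phi> (t i) ` carrier G" for i
    \<comment> \<open>There are n + 1 subgroups, hence n successive quotients, one for each
      partition interval.\<close>
    define Gs where "Gs = map H [0..<Suc n]"
    have len: "length Gs = Suc n" and nth: "\<And>i. i \<le> n \<Longrightarrow> Gs ! i = H i"
      by (simp_all add: Gs_def del: upt_Suc)
    have "Gs \<in> amenable_chains G T"
      unfolding amenable_chains_def
    proof (intro CollectI conjI ballI allI impI)
      show "Gs \<noteq> []" using len by auto
      then show "hd Gs = {\<one>\<^bsub>G\<^esub>}" "last Gs = carrier G"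
        using assms(10,11) t(1,2) by (simp_all add: hd_conv_nth last_conv_nth len nth H_def)
    next
      fix K assume "K \<in> set Gs"
      then obtain i where "i \<le> n" "K = H i"
        unfolding Gs_def by (auto simp: less_Suc_eq_le simp del: upt_Suc)
      then show "subgroup K G" "amenable (G\<lparr>carrier := K\<rparr>) (subtopology T K)"
        using sub amen t(3) by (simp_all add: H_def)
    next
      fix i assume "i < length Gs - 1"
      then have "i < n" by (simp add: len)
      then have "H i \<subseteq> H (Suc i)" unfolding H_def by (intro assms(12)) (simp_all add: t)
      then show "Gs ! i \<subseteq> Gs ! Suc i" using \<open>i < n\<close> by (simp add: nth)
    qed
    moreover have "chain_length G d Gs \<le> sqrt (4 * C\<^sup>2 / n)"
    proof -
      have diam: "(SUP g\<in>carrier G. SUP (A, B) \<in> (lcosets\<^bsub>G\<lparr>carrier := H (Suc i)\<rparr>\<^esub> (H i)) \<times>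
          (lcosets\<^bsub>G\<lparr>carrier := H (Suc i)\<rparr>\<^esub> (H i)). coset_dist G d (H i) g A B) \<in> {0..C * (2 / n)}"
        (is "(SUP g\<in>_. Sup (?f g ` (?L \<times> ?L))) \<in> _") if i: "i < n" for i
      proof (intro cSUP_atLeastAtMost)
        have iD: "t i \<in> D" "t (Suc i) \<in> D" using i t(3) by auto
        \<comment> \<open>Restricting the carrier leaves multiplication unchanged, so these cosets
          are cosets in \<open>G\<close> with representatives in \<open>H (Suc i)\<close>.\<close>
        have L: "\<exists>x\<in>H (Suc i). A = x <#\<^bsub>G\<^esub> H i" if "A \<in> ?L" for A
          using that by (auto simp: LCOSETS_def l_coset_def)
        show "carrier G \<noteq> {}" by auto
        show "?L \<times> ?L \<noteq> {}" by (auto simp: LCOSETS_def H_def)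
        fix g p assume g: "g \<in> carrier G" and "p \<in> ?L \<times> ?L"
        then obtain x y where p: "p = (x <#\<^bsub>G\<^esub> H i, y <#\<^bsub>G\<^esub> H i)" "x \<in> H (Suc i)" "y \<in> H (Suc i)"
          using L by blast
        have "C * \<bar>t i - t (Suc i)\<bar> \<le> C * (2 / n)"
          using t(4)[OF i] C(1) by (intro mult_left_mono) auto
        then have "d (g \<otimes>\<^bsub>G\<^esub> \<phi> (t i) h) (g \<otimes>\<^bsub>G\<^esub> \<phi> (t (Suc i)) h) \<le> C * (2 / n)"
          if "g \<in> carrier G" "h \<in> carrier G" for g h
          using C(2)[OF iD that] by linarith
        then have "coset_dist G d (H i) g (x <#\<^bsub>G\<^esub> H i) (y <#\<^bsub>G\<^esub> H i) \<in> {0..C * (2 / n)}"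
          unfolding H_def using assms(2,5,9) iD g p(2,3)
          by (intro coset_dist_image_bound[where \<psi> = "\<phi> (t (Suc i))"]) (simp_all add: H_def)
        then show "?f g p \<in> {0..C * (2 / n)}" by (simp add: p(1))
      qed
      let ?S = "\<lambda>i. SUP g\<in>carrier G. SUP (A, B) \<in> (lcosets\<^bsub>G\<lparr>carrier := H (Suc i)\<rparr>\<^esub> (H i)) \<times>
          (lcosets\<^bsub>G\<lparr>carrier := H (Suc i)\<rparr>\<^esub> (H i)). coset_dist G d (H i) g A B"
      have "chain_length G d Gs = sqrt (\<Sum>i<n. (?S i)\<^sup>2)"
        unfolding chain_length_def
        by (intro arg_cong[where f = sqrt] sum.cong) (simp_all add: len nth)
      \<comment> \<open>Squaring is monotone here because \<open>diam\<close> also gives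
        nonnegativity. The squares matter: n terms of size (2C/n)^2 add up to 4C^2/n, whereas the
        unsquared bounds would add up to 2C.\<close>
      also have "(\<Sum>i<n. (?S i)\<^sup>2) \<le> (\<Sum>i<n. (C * (2 / n))\<^sup>2)"
        using diam by (intro sum_mono power_mono) (simp_all only: atLeastAtMost_iff lessThan_iff)
      also have "\<dots> = 4 * C\<^sup>2 / n"
        using n by (simp add: power2_eq_square field_simps)
      finally show ?thesis by simp
    qed
    ultimately show ?thesis
      unfolding amenable_length_def by (intro INF_lower2[of Gs] ennreal_leI)
  qed
  have "(\<lambda>n. sqrt (4 * C\<^sup>2 / real n)) \<longlonglongrightarrow> sqrt 0"
    by (intro tendsto_real_sqrt lim_const_over_n)
  then have "(\<lambda>n. ennreal (sqrt (4 * C\<^sup>2 / real n))) \<longlonglongrightarrow> ennreal 0"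
    by (intro tendsto_ennrealI) simp
  \<comment> \<open>The length does not depend on n, so it lies below the limit of the bounds. These
    are available from n = 1 on, which suffices for the limit.\<close>
  then have "amenable_length G T d \<le> ennreal 0"
    by (rule tendsto_lowerbound) (auto intro!: eventually_sequentiallyI[of 1] bound)
  then show ?thesis by simp
qed

end
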